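(* Let $k$ be an algebraically closed field, let $L$ be a coassociative Lie algebra over $k$, and let $C$ be the coradical of $L$. Then $[C,C]=0$. As a consequence, cosemisimple coalgebras are rigid: if $(L,\delta)$ is a cosemisimple coalgebra and $[\,,\,]$ is a Lie bracket on $L$ making $(L,[\,,\,],\delta)$ a coassociative Lie algebra, then $[\,,\,]=0$.
   Context: Everything is over $k$ and $\otimes=\otimes_k$. A coassociative Lie algebra is a Lie algebra $(L,[\,,\,])$ together with a linear map $\delta:L\to L\otimes L$ such that $(\delta\otimes 1)\delta=(1\otimes\delta)\delta$ (no counit is required) and, for all $a,b\in L$, $$\delta([a,b])=[a\otimes 1+1\otimes a,\delta(b)]+[\delta(a),b\otimes 1+1\otimes b]+[\delta(a),\delta(b)],$$ where this equation is taken in $U\otimes U$, $U$ being the usual universal enveloping algebra of the Lie algebra $L$, $L\otimes L$ being viewed as a subspace of $U\otimes U$, and the brackets on the right being commutators in $U\otimes U$. The $n\times n$ matrix coalgebra has a basis $\{x_{ij}\}_{1\le i,j\le n}$ with $\delta(x_{ij})=\sum_{s=1}^n x_{is}\otimes x_{sj}$. For a coalgebra $(L,\delta)$ (without counit), the coradical $C$ is the sum of all its subcoalgebras that are simple coalgebras with counit; since $k$ is algebraically closed these are isomorphic to matrix coalgebras, so that $C$ is a direct sum of matrix coalgebras. (One-dimensional subspaces $kx$ with $\delta(x)=0$ do not count as simple here.) A coalgebra is cosemisimple if it equals its coradical. *)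

theory Defs
  imports "HOL-Library.Poly_Mapping" "HOL-Computational_Algebra.Polynomial"
begin

section \<open>Free vector spaces\<close>

text \<open>
  The free vector space on a type \<open>'x\<close> over a field \<open>'k\<close> is the type \<open>'x \<Rightarrow>\<^sub>0 'k\<close> of finitely
  supported functions, with basis the elements \<open>bas x\<close>.
\<close>

definition bas :: "'x \<Rightarrow> ('x \<Rightarrow>\<^sub>0 'k::field)"
  where "bas x = Poly_Mapping.single x 1"

definition fscale :: "'k::field \<Rightarrow> ('x \<Rightarrow>\<^sub>0 'k) \<Rightarrow> ('x \<Rightarrow>\<^sub>0 'k)"
  where "fscale c = Poly_Mapping.map ((*) c)"

lemma lookup_fscale: "Poly_Mapping.lookup (fscale c s) x = c * Poly_Mapping.lookup s x"
  by (auto simp: fscale_def map.rep_eq when_def)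

interpretation free: vector_space "fscale :: 'k::field \<Rightarrow> ('x \<Rightarrow>\<^sub>0 'k) \<Rightarrow> _"
  by standard (auto intro!: poly_mapping_eqI simp: lookup_fscale lookup_add algebra_simps)

text \<open>
  The linear extension of a map \<open>f\<close> on basis elements, with values in a vector space with
  scalar multiplication \<open>scale\<close>.
\<close>

definition lin_ext ::
    "('k::field \<Rightarrow> 'v::ab_group_add \<Rightarrow> 'v) \<Rightarrow> ('x \<Rightarrow> 'v) \<Rightarrow> ('x \<Rightarrow>\<^sub>0 'k) \<Rightarrow> 'v"
  where "lin_ext scale f s = (\<Sum>x\<in>Poly_Mapping.keys s. scale (Poly_Mapping.lookup s x) (f x))"


section \<open>Tensor products\<close>

text \<open>
  For subspaces \<open>M\<close> of \<open>V\<close> and \<open>N\<close> of \<open>W\<close>, the tensor product \<open>V/M \<otimes> W/N\<close> is the free vector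
  space on \<open>V \<times> W\<close> modulo the following subspace; \<open>bas (v, w)\<close> represents the tensor of the
  classes of \<open>v\<close> and \<open>w\<close>. For \<open>M = N = {0}\<close> this is the usual construction of \<open>V \<otimes> W\<close>.
\<close>

definition tensor_rels ::
    "('k::field \<Rightarrow> 'v::ab_group_add \<Rightarrow> 'v) \<Rightarrow> 'v set \<Rightarrow>
     ('k \<Rightarrow> 'w::ab_group_add \<Rightarrow> 'w) \<Rightarrow> 'w set \<Rightarrow> ('v \<times> 'w \<Rightarrow>\<^sub>0 'k) set"
  where "tensor_rels sV M sW N = free.span (
      {bas (v + v', w) - bas (v, w) - bas (v', w) | v v' w. True}
    \<union> {bas (v, w + w') - bas (v, w) - bas (v, w') | v w w'. True}
    \<union> {bas (sV c v, w) - fscale c (bas (v, w)) | c v w. True}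
    \<union> {bas (v, sW c w) - fscale c (bas (v, w)) | c v w. True}
    \<union> {bas (v, w) | v w. v \<in> M \<or> w \<in> N})"

definition tensor3_rels ::
    "('k::field \<Rightarrow> 'v::ab_group_add \<Rightarrow> 'v) \<Rightarrow> ('v \<times> 'v \<times> 'v \<Rightarrow>\<^sub>0 'k) set"
  where "tensor3_rels sV = free.span (
      {bas (u + u', v, w) - bas (u, v, w) - bas (u', v, w) | u u' v w. True}
    \<union> {bas (u, v + v', w) - bas (u, v, w) - bas (u, v', w) | u v v' w. True}
    \<union> {bas (u, v, w + w') - bas (u, v, w) - bas (u, v, w') | u v w w'. True}
    \<union> {bas (sV c u, v, w) - fscale c (bas (u, v, w)) | c u v w. True}
    \<union> {bas (u, sV c v, w) - fscale c (bas (u, v, w)) | c u v w. True}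
    \<union> {bas (u, v, sV c w) - fscale c (bas (u, v, w)) | c u v w. True})"

text \<open>
  \<open>V \<otimes> V\<close> is the set of cosets of the relation subspace; an element of a coset is called a
  representative of that tensor.
\<close>

definition tensor_class ::
    "('k::field \<Rightarrow> 'v::ab_group_add \<Rightarrow> 'v) \<Rightarrow> ('v \<times> 'v \<Rightarrow>\<^sub>0 'k) \<Rightarrow> ('v \<times> 'v \<Rightarrow>\<^sub>0 'k) set"
  where "tensor_class sV s = {t. t - s \<in> tensor_rels sV {0} sV {0}}"

definition tensor_square ::
    "('k::field \<Rightarrow> 'v::ab_group_add \<Rightarrow> 'v) \<Rightarrow> ('v \<times> 'v \<Rightarrow>\<^sub>0 'k) set set"
  where "tensor_square sV = {tensor_class sV s | s. True}"


section \<open>Coalgebras without counit\<close>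

locale coassoc_coalgebra = vector_space scale
  for scale :: "'k::field \<Rightarrow> 'l::ab_group_add \<Rightarrow> 'l" +
  fixes delta :: "'l \<Rightarrow> ('l \<times> 'l \<Rightarrow>\<^sub>0 'k) set"
  assumes delta_in: "delta x \<in> tensor_square scale"
    and delta_add: "s \<in> delta x \<Longrightarrow> t \<in> delta y \<Longrightarrow> s + t \<in> delta (x + y)"
    and delta_scale: "s \<in> delta x \<Longrightarrow> fscale c s \<in> delta (scale c x)"
    \<comment> \<open>\<open>(\<delta> \<otimes> 1) \<delta> = (1 \<otimes> \<delta>) \<delta>\<close>, computed with representatives \<open>d y\<close> of the tensors \<open>\<delta> y\<close>\<close>
    and coassoc: "(\<And>y. d y \<in> delta y) \<Longrightarrow>
      lin_ext fscale (\<lambda>(a, b). lin_ext fscale (\<lambda>(a1, a2). bas (a1, a2, b)) (d a)) (d x)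
    - lin_ext fscale (\<lambda>(a, b). lin_ext fscale (\<lambda>(b1, b2). bas (a, b1, b2)) (d b)) (d x)
      \<in> tensor3_rels scale"
begin

text \<open>
  \<open>D \<otimes> D\<close>, as a subspace of the tensor square, consists of the tensors having a representative
  supported on \<open>D \<times> D\<close>.
\<close>

definition subcoalgebra :: "'l set \<Rightarrow> bool"
  where "subcoalgebra D \<longleftrightarrow> subspace D \<and> (\<forall>x\<in>D. \<exists>t\<in>delta x. Poly_Mapping.keys t \<subseteq> D \<times> D)"

definition simple_subcoalgebra :: "'l set \<Rightarrow> bool"
  where "simple_subcoalgebra D \<longleftrightarrow> subcoalgebra D \<and> D \<noteq> {0}
    \<and> (\<forall>E. subcoalgebra E \<and> E \<subseteq> D \<longrightarrow> E = {0} \<or> E = D)"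

text \<open>
  A counit on \<open>D\<close> is a linear form on \<open>D\<close>; its values outside \<open>D\<close> play no role.
\<close>

definition counit_on :: "'l set \<Rightarrow> ('l \<Rightarrow> 'k) \<Rightarrow> bool"
  where "counit_on D eps \<longleftrightarrow>
      (\<forall>x\<in>D. \<forall>y\<in>D. eps (x + y) = eps x + eps y)
    \<and> (\<forall>c. \<forall>x\<in>D. eps (scale c x) = c * eps x)
    \<and> (\<forall>x\<in>D. \<forall>t\<in>delta x. Poly_Mapping.keys t \<subseteq> D \<times> D \<longrightarrow>
          lin_ext scale (\<lambda>(a, b). scale (eps a) b) t = x
        \<and> lin_ext scale (\<lambda>(a, b). scale (eps b) a) t = x)"

definition coradical :: "'l set"
  where "coradical = span (\<Union>{D. simple_subcoalgebra D \<and> (\<exists>eps. counit_on D eps)})"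

definition cosemisimple :: bool
  where "cosemisimple \<longleftrightarrow> coradical = UNIV"

end


section \<open>Lie algebras and their universal enveloping algebras\<close>

locale lie_alg = vector_space scale
  for scale :: "'k::field \<Rightarrow> 'l::ab_group_add \<Rightarrow> 'l" +
  fixes bracket :: "'l \<Rightarrow> 'l \<Rightarrow> 'l"
  assumes bracket_add_left: "bracket (x + y) z = bracket x z + bracket y z"
    and bracket_add_right: "bracket x (y + z) = bracket x y + bracket x z"
    and bracket_scale_left: "bracket (scale c x) y = scale c (bracket x y)"
    and bracket_scale_right: "bracket x (scale c y) = scale c (bracket x y)"
    and bracket_self: "bracket x x = 0"
    and jacobi: "bracket x (bracket y z) + bracket y (bracket z x) + bracket z (bracket x y) = 0"

text \<open>
  Words, written additively because the convolution product of \<open>\<Rightarrow>\<^sub>0\<close> requires an additive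
  monoid. With that product, \<open>'l word \<Rightarrow>\<^sub>0 'k\<close> is the free unital associative algebra on the
  set \<open>'l\<close>.
\<close>

datatype 'l word = Word (letters: "'l list")

instantiation word :: (type) monoid_add
begin

definition zero_word :: "'l word"
  where "zero_word = Word []"

definition plus_word :: "'l word \<Rightarrow> 'l word \<Rightarrow> 'l word"
  where "plus_word v w = Word (letters v @ letters w)"

instance
  by standard (auto simp: zero_word_def plus_word_def)

end

type_synonym ('l, 'k) free_alg = "'l word \<Rightarrow>\<^sub>0 'k"

definition gen :: "'l \<Rightarrow> ('l, 'k::field) free_alg"
  where "gen x = bas (Word [x])"

inductive_set two_sided_ideal :: "'r::ring_1 set \<Rightarrow> 'r set" for S :: "'r set" where
  zero: "0 \<in> two_sided_ideal S"
| base: "s \<in> S \<Longrightarrow> a * s * b \<in> two_sided_ideal S"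
| add: "u \<in> two_sided_ideal S \<Longrightarrow> v \<in> two_sided_ideal S \<Longrightarrow> u + v \<in> two_sided_ideal S"

text \<open>
  The universal enveloping algebra \<open>U\<close> is the quotient of the free algebra by the ideal
  \<open>env_ideal\<close>. The relations in the first two sets turn the free algebra on the set \<open>L\<close> into the
  tensor algebra of the vector space \<open>L\<close>.
\<close>

definition env_ideal ::
    "('k::field \<Rightarrow> 'l::ab_group_add \<Rightarrow> 'l) \<Rightarrow> ('l \<Rightarrow> 'l \<Rightarrow> 'l) \<Rightarrow> ('l, 'k) free_alg set"
  where "env_ideal scale bracket = two_sided_ideal (
      {gen (x + y) - gen x - gen y | x y. True}
    \<union> {gen (scale c x) - fscale c (gen x) | c x. True}
    \<union> {gen x * gen y - gen y * gen x - gen (bracket x y) | x y. True})"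

text \<open>
  Elements of \<open>U \<otimes> U\<close> are represented by formal linear combinations of pairs \<open>(p, q)\<close> of
  elements of the free algebra, and \<open>UU_eq\<close> is equality in \<open>U \<otimes> U\<close>. The product is
  \<open>(p \<otimes> q) (p' \<otimes> q') = p p' \<otimes> q q'\<close>.
\<close>

type_synonym ('l, 'k) free_alg2 = "('l, 'k) free_alg \<times> ('l, 'k) free_alg \<Rightarrow>\<^sub>0 'k"

definition UU_eq ::
    "('k::field \<Rightarrow> 'l::ab_group_add \<Rightarrow> 'l) \<Rightarrow> ('l \<Rightarrow> 'l \<Rightarrow> 'l) \<Rightarrow>
     ('l, 'k) free_alg2 \<Rightarrow> ('l, 'k) free_alg2 \<Rightarrow> bool"
  where "UU_eq scale bracket s t \<longleftrightarrow>
    s - t \<in> tensor_rels fscale (env_ideal scale bracket) fscale (env_ideal scale bracket)"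

definition tmul ::
    "('l, 'k::field) free_alg2 \<Rightarrow> ('l, 'k) free_alg2 \<Rightarrow> ('l, 'k) free_alg2"
  where "tmul s t =
    lin_ext fscale (\<lambda>(p, q). lin_ext fscale (\<lambda>(p', q'). bas (p * p', q * q')) t) s"

definition tcomm ::
    "('l, 'k::field) free_alg2 \<Rightarrow> ('l, 'k) free_alg2 \<Rightarrow> ('l, 'k) free_alg2"
  where "tcomm s t = tmul s t - tmul t s"

definition prim :: "'l \<Rightarrow> ('l, 'k::field) free_alg2"
  where "prim a = bas (gen a, 1) + bas (1, gen a)"

text \<open>The map \<open>L \<otimes> L \<rightarrow> U \<otimes> U\<close>, on representatives.\<close>

definition emb2 :: "('l \<times> 'l \<Rightarrow>\<^sub>0 'k::field) \<Rightarrow> ('l, 'k) free_alg2"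
  where "emb2 = lin_ext fscale (\<lambda>(a, b). bas (gen a, gen b))"


section \<open>Coassociative Lie algebras\<close>

locale coassoc_lie_alg =
  lie_alg scale bracket + coassoc_coalgebra scale delta
  for scale :: "'k::field \<Rightarrow> 'l::ab_group_add \<Rightarrow> 'l"
    and bracket :: "'l \<Rightarrow> 'l \<Rightarrow> 'l"
    and delta :: "'l \<Rightarrow> ('l \<times> 'l \<Rightarrow>\<^sub>0 'k) set" +
  assumes delta_bracket:
    "r \<in> delta (bracket a b) \<Longrightarrow> s \<in> delta a \<Longrightarrow> t \<in> delta b \<Longrightarrow>
     UU_eq scale bracket (emb2 r)
       (tcomm (prim a) (emb2 t) + tcomm (emb2 s) (prim b) + tcomm (emb2 s) (emb2 t))"

end

theory Submission
  imports Defs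
begin

text \<open>
  If \<open>C\<close> is a subcoalgebra with counit \<open>\<epsilon>\<close>, then \<open>\<Sum> f(a\<^sub>2) a\<^sub>1 = a\<close> for every \<open>a \<in> C\<close> and every
  linear form \<open>f\<close> on \<open>L\<close> that restricts to \<open>\<epsilon>\<close> on \<open>C\<close>; here \<open>\<delta>(a) = \<Sum> a\<^sub>1 \<otimes> a\<^sub>2\<close>. Hence two
  counital subcoalgebras commute as soon as one linear form restricts to both counits and
  \<open>\<Sum> f(a\<^sub>2) f(b\<^sub>2) [a\<^sub>1, b\<^sub>1] = 0\<close> for all \<open>a, b \<in> L\<close>. The form \<open>f\<close> exists because the two counits
  agree on the intersection (\<open>counits_agree\<close>), and the identity holds for every linear form \<open>f\<close>
  (\<open>bracket_contract\<close>). The coradical is spanned by counital subcoalgebras, so it is abelian.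

  The identity is read off from the formula for \<open>\<delta>([a, b])\<close> in \<open>U \<otimes> U\<close>. Apply to it \<open>\<Phi> \<otimes> \<Psi>\<close>, where
  \<open>\<Phi>\<close> is a form on \<open>U\<close> that extends an arbitrary linear form \<open>l\<close> on \<open>L\<close>, and \<open>\<Psi>\<close> is a form on \<open>U\<close>
  with \<open>\<Psi>(1) = 0\<close>, \<open>\<Psi>(x) = 0\<close> and \<open>\<Psi>(x y) = f(x) f(y)\<close> for \<open>x, y \<in> L\<close>. The left side vanishes,
  since its second tensor factors lie in \<open>L\<close>. In \<open>[a \<otimes> 1 + 1 \<otimes> a, \<delta>(b)]\<close> the second factors are
  \<open>b\<^sub>2\<close> and \<open>[a, b\<^sub>2]\<close>, again in \<open>L\<close>, and likewise for the second term. In \<open>[\<delta>(a), \<delta>(b)]\<close> the second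
  factors \<open>a\<^sub>2 b\<^sub>2\<close> and \<open>b\<^sub>2 a\<^sub>2\<close> have the same value under \<open>\<Psi>\<close>, so that what remains is
  \<open>\<Sum> l([a\<^sub>1, b\<^sub>1]) f(a\<^sub>2) f(b\<^sub>2) = 0\<close>. As \<open>l\<close> is arbitrary, the identity follows.

  That \<open>\<Phi>\<close> and \<open>\<Psi>\<close> exist is a form of the Poincare-Birkhoff-Witt theorem: a form on \<open>U\<close> may be
  prescribed arbitrarily on the ordered monomials in a basis of \<open>L\<close>. The values on the other
  monomials come from exchanging neighbouring letters that are out of order, and by the Jacobi
  identity they do not depend on which letters are exchanged first (\<open>straighten_descent\<close>).
\<close>

section \<open>Linear forms\<close>

text \<open>
  In contrast to \<open>linear sc (*)\<close>, this does not include the vector space axioms for \<open>sc\<close>, which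
  would otherwise have to be supplied at each use.
\<close>

definition linear_form :: "('k::field \<Rightarrow> 'v::ab_group_add \<Rightarrow> 'v) \<Rightarrow> ('v \<Rightarrow> 'k) \<Rightarrow> bool"
  where "linear_form sc f \<longleftrightarrow> (\<forall>x y. f (x + y) = f x + f y) \<and> (\<forall>c x. f (sc c x) = c * f x)"

lemma linear_formI:
  "(\<And>x y. f (x + y) = f x + f y) \<Longrightarrow> (\<And>c x. f (sc c x) = c * f x) \<Longrightarrow> linear_form sc f"
  by (simp add: linear_form_def)

lemma linear_form_add: "linear_form sc f \<Longrightarrow> f (x + y) = f x + f y"
  and linear_form_scale: "linear_form sc f \<Longrightarrow> f (sc c x) = c * f x"
  by (simp_all add: linear_form_def)

lemma linear_form_zero: "linear_form sc f \<Longrightarrow> f 0 = 0"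
  using linear_form_add[of sc f 0 0] by (metis add_0 add_right_cancel)

lemma linear_form_minus: "linear_form sc f \<Longrightarrow> f (- x) = - f x"
  using linear_form_add[of sc f x "- x"]
  by (simp add: linear_form_zero eq_neg_iff_add_eq_0 add.commute)

lemma linear_form_diff: "linear_form sc f \<Longrightarrow> f (x - y) = f x - f y"
  using linear_form_add[of sc f x "- y"] linear_form_minus[of sc f y] by simp

lemma linear_form_sum: "linear_form sc f \<Longrightarrow> f (sum g A) = (\<Sum>i\<in>A. f (g i))"
  by (induction A rule: infinite_finite_induct) (simp_all add: linear_form_zero linear_form_add)

lemma vector_space_mult: "vector_space ((*) :: 'k::field \<Rightarrow> 'k \<Rightarrow> 'k)"
  by unfold_locales (simp_all add: algebra_simps)

context vector_space
begin

lemma linear_form_extension: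
  assumes S: "subspace S"
    and add: "\<And>x y. x \<in> S \<Longrightarrow> y \<in> S \<Longrightarrow> h (x + y) = h x + h y"
    and scl: "\<And>c x. x \<in> S \<Longrightarrow> h (scale c x) = c * h x"
  shows "\<exists>g. linear_form scale g \<and> (\<forall>x\<in>S. g x = h x)"
proof -
  interpret vector_space_pair scale "(*) :: 'a \<Rightarrow> 'a \<Rightarrow> 'a"
    by (intro vector_space_pair.intro vector_space_axioms vector_space_mult)
  obtain B where B: "B \<subseteq> S" "independent B" "S \<subseteq> span B"
    using maximal_independent_subset[of S] by blast
  obtain g where g: "Vector_Spaces.linear scale (*) g" "\<And>b. b \<in> B \<Longrightarrow> g b = h b"
    using linear_independent_extend[OF B(2), of h] by blast
  have lin: "linear_form scale g"
    using g(1) by (auto simp: linear_form_def Vector_Spaces.linear_iff)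
  have h0: "h 0 = 0" using scl[of 0 0] subspace_0[OF S] by simp
  have "subspace {x \<in> S. g x = h x}"
    using S by (auto simp: subspace_def linear_form_zero[OF lin] linear_form_add[OF lin]
        linear_form_scale[OF lin] h0 add scl)
  then have "span B \<subseteq> {x \<in> S. g x = h x}"
    using B(1) g(2) by (intro span_minimal) auto
  then show ?thesis using lin B(3) by blast
qed

lemma linear_form_separates:
  assumes "\<And>f. linear_form scale f \<Longrightarrow> f x = 0"
  shows "x = 0"
proof (rule ccontr)
  assume "x \<noteq> 0"
  interpret vector_space_pair scale "(*) :: 'a \<Rightarrow> 'a \<Rightarrow> 'a"
    by (intro vector_space_pair.intro vector_space_axioms vector_space_mult)
  have "independent {x}" using \<open>x \<noteq> 0\<close> by simp
  then obtain g where "Vector_Spaces.linear scale (*) g" "g x = 1"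
    using linear_independent_extend[of "{x}" "\<lambda>_. 1"] by blast
  then show False using assms[of g] by (auto simp: linear_form_def Vector_Spaces.linear_iff)
qed

lemma linear_form_glue:
  assumes C: "subspace C" and D: "subspace D"
    and f: "linear_form scale f" and g: "linear_form scale g"
    and agree: "\<And>x. x \<in> C \<Longrightarrow> x \<in> D \<Longrightarrow> f x = g x"
  shows "\<exists>h. linear_form scale h \<and> (\<forall>x\<in>C. h x = f x) \<and> (\<forall>x\<in>D. h x = g x)"
proof -
  let ?S = "{c + d |c d. c \<in> C \<and> d \<in> D}"
  define p where "p x = (SOME d. d \<in> D \<and> x - d \<in> C)" for x
  define h where "h x = f (x - p x) + g (p x)" for x
  \<comment> \<open>two choices of \<open>p x\<close> differ by an element of \<open>C \<inter> D\<close>, where \<open>f\<close> and \<open>g\<close> agree\<close>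
  have h: "h (c + d) = f c + g d" if "c \<in> C" "d \<in> D" for c d
  proof -
    let ?x = "c + d"
    have p: "p ?x \<in> D \<and> ?x - p ?x \<in> C"
      unfolding p_def by (rule someI[of _ d]) (use that in simp)
    have "(?x - p ?x) - c \<in> C" using p that C by (blast intro: subspace_diff)
    then have "d - p ?x \<in> C" by simp
    moreover have "d - p ?x \<in> D" using p that D by (blast intro: subspace_diff)
    ultimately have "f (d - p ?x) = g (d - p ?x)" by (rule agree)
    then show ?thesis
      by (simp add: h_def linear_form_diff[OF f] linear_form_add[OF f] linear_form_diff[OF g] algebra_simps)
  qed
  have "\<exists>k. linear_form scale k \<and> (\<forall>x\<in>?S. k x = h x)"
  proof (rule linear_form_extension)
    show "subspace ?S" using C D by (rule subspace_sums)
  next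
    fix x y assume "x \<in> ?S" "y \<in> ?S"
    then obtain a b a' b' where e: "x = a + b" "y = a' + b'" "a \<in> C" "a' \<in> C" "b \<in> D" "b' \<in> D" by blast
    have "h ((a + a') + (b + b')) = f (a + a') + g (b + b')"
      using e C D by (intro h subspace_add)
    moreover have "(a + a') + (b + b') = x + y" using e by (simp add: algebra_simps)
    ultimately show "h (x + y) = h x + h y"
      using e h[of a b] h[of a' b'] by (simp add: linear_form_add[OF f] linear_form_add[OF g])
  next
    fix c x assume "x \<in> ?S"
    then obtain a b where e: "x = a + b" "a \<in> C" "b \<in> D" by blast
    have "h (scale c a + scale c b) = f (scale c a) + g (scale c b)"
      using e C D by (intro h subspace_scale)
    then show "h (scale c x) = c * h x"
      using e h[of a b] by (simp add: scale_right_distrib distrib_left linear_form_scale[OF f] linear_form_scale[OF g])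
  qed
  then obtain k where k: "linear_form scale k" "\<And>x. x \<in> ?S \<Longrightarrow> k x = h x" by blast
  have "k x = f x" if "x \<in> C" for x
    using k(2)[of "x + 0"] h[of x 0] that subspace_0[OF D] linear_form_zero[OF g] by force
  moreover have "k x = g x" if "x \<in> D" for x
    using k(2)[of "0 + x"] h[of 0 x] that subspace_0[OF C] linear_form_zero[OF f] by force
  ultimately show ?thesis using k(1) by blast
qed

end

section \<open>Forms on the enveloping algebra\<close>

text \<open>
  The termination measure for straightening: \<open>w\<close> has a neighbouring pair out of order unless it
  is sorted, and exchanging such a pair lowers this number.
\<close>

fun inversions :: "('a \<Rightarrow> 'a \<Rightarrow> bool) \<Rightarrow> 'a list \<Rightarrow> nat" where
  "inversions lt [] = 0"
| "inversions lt (x # w) = length (filter (\<lambda>y. lt y x) w) + inversions lt w"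

lemma inversions_swap:
  assumes "lt y x" "\<not> lt x y"
  shows "inversions lt (u @ y # x # v) < inversions lt (u @ x # y # v)"
  using assms by (induction u) auto

context lie_alg
begin

lemma bracket_skew: "bracket y x = - bracket x y"
proof -
  have "bracket (x + y) (x + y) = bracket x y + bracket y x"
    by (simp only: bracket_add_left bracket_add_right bracket_self[of x] bracket_self[of y] add_0_left add_0_right add.commute)
  then have "bracket x y + bracket y x = 0"
    by (simp add: bracket_self)
  then show ?thesis by (simp add: eq_neg_iff_add_eq_0 add.commute)
qed

lemma bracket_zero [simp]: "bracket 0 x = 0" "bracket x 0 = 0"
  using bracket_add_left[of 0 0 x] bracket_add_right[of x 0 0] by simp_all

lemma bracket_minus_left: "bracket (- x) y = - bracket x y"
  using bracket_add_left[of x "- x" y] by (simp add: eq_neg_iff_add_eq_0 add.commute)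

text \<open>
  A linear form on \<open>U\<close>, given by its values on the products of elements of \<open>L\<close>. The first two
  conditions say that it factors through the tensor algebra, the third that it respects
  \<open>x y - y x = [x, y]\<close>.
\<close>

definition env_form :: "('l list \<Rightarrow> 'k) \<Rightarrow> bool"
  where "env_form \<Phi> \<longleftrightarrow>
      (\<forall>u x y v. \<Phi> (u @ (x + y) # v) = \<Phi> (u @ x # v) + \<Phi> (u @ y # v))
    \<and> (\<forall>u c x v. \<Phi> (u @ scale c x # v) = c * \<Phi> (u @ x # v))
    \<and> (\<forall>u x y v. \<Phi> (u @ x # y # v) = \<Phi> (u @ y # x # v) + \<Phi> (u @ bracket x y # v))"

end

text \<open>
  The order decides which pairs of neighbouring letters are exchanged. It is imposed on all
  vectors rather than on the elements of a basis, so that words need no side condition on their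
  letters.
\<close>

locale ordered_lie_alg = lie_alg scale bracket
  for scale :: "'k::field \<Rightarrow> 'l::ab_group_add \<Rightarrow> 'l" and bracket +
  fixes lt :: "'l \<Rightarrow> 'l \<Rightarrow> bool"
  assumes lt_asym: "lt x y \<Longrightarrow> \<not> lt y x"
    and lt_trans: "lt x y \<Longrightarrow> lt y z \<Longrightarrow> lt x z"
    and lt_total: "x \<noteq> y \<Longrightarrow> lt x y \<or> lt y x"
begin

lemma inversions_descent:
  "lt y x \<Longrightarrow> inversions lt (u @ y # x # v) < inversions lt (u @ x # y # v)"
  by (rule inversions_swap[of lt]) (simp_all add: lt_asym)

definition coord :: "'l \<Rightarrow> 'l \<Rightarrow> 'k" where "coord = representation (extend_basis {})"

text \<open>The linear form with values \<open>h\<close> on the basis.\<close>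

definition extend :: "('l \<Rightarrow> 'k) \<Rightarrow> 'l \<Rightarrow> 'k"
  where "extend h x = (\<Sum>b | coord x b \<noteq> 0. coord x b * h b)"

lemma basis_independent: "independent (extend_basis {})" and span_basis: "span (extend_basis {}) = UNIV"
  by (rule independent_extend_basis[OF independent_empty], rule span_extend_basis[OF independent_empty])

lemma finite_coord: "finite {b. coord x b \<noteq> 0}"
  by (simp add: coord_def finite_representation)

lemma extend_eq_sum: "finite S \<Longrightarrow> {b. coord x b \<noteq> 0} \<subseteq> S \<Longrightarrow> extend h x = (\<Sum>b\<in>S. coord x b * h b)"
  unfolding extend_def by (rule sum.mono_neutral_left) auto

lemma linear_form_extend: "linear_form scale (extend h)"
proof (rule linear_formI)
  fix x y
  have c: "coord (x + y) = (\<lambda>b. coord x b + coord y b)"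
    unfolding coord_def by (rule representation_add) (simp_all add: basis_independent span_basis)
  let ?S = "{b. coord x b \<noteq> 0} \<union> {b. coord y b \<noteq> 0}"
  have fin: "finite ?S" by (simp add: finite_coord)
  have "extend h z = (\<Sum>b\<in>?S. coord z b * h b)" if "z \<in> {x, y, x + y}" for z
    using that by (intro extend_eq_sum fin) (auto simp: c)
  then show "extend h (x + y) = extend h x + extend h y"
    by (simp add: c algebra_simps sum.distrib)
next
  fix a x
  have c: "coord (scale a x) = (\<lambda>b. a * coord x b)"
    unfolding coord_def by (rule representation_scale) (simp_all add: basis_independent span_basis)
  have "extend h (scale a x) = (\<Sum>b | coord x b \<noteq> 0. coord (scale a x) b * h b)"
    by (rule extend_eq_sum) (auto simp: c finite_coord)
  then show "extend h (scale a x) = a * extend h x"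
    by (simp add: c extend_def sum_distrib_left mult.assoc)
qed

lemmas extend_add = linear_form_add[OF linear_form_extend]
  and extend_scale = linear_form_scale[OF linear_form_extend]
  and extend_zero [simp] = linear_form_zero[OF linear_form_extend]
  and extend_minus = linear_form_minus[OF linear_form_extend]

lemma extend_linear_form:
  assumes "linear_form scale g"
  shows "extend g x = g x"
proof -
  have "x = (\<Sum>b | coord x b \<noteq> 0. scale (coord x b) b)"
    unfolding coord_def by (rule sum_nonzero_representation_eq[symmetric]) (simp_all add: basis_independent span_basis)
  then have "g x = g (\<Sum>b | coord x b \<noteq> 0. scale (coord x b) b)" by simp
  then show ?thesis
    by (simp add: extend_def linear_form_sum[OF assms] linear_form_scale[OF assms])
qed

lemma extend_fun_add: "extend (\<lambda>b. h b + h' b) x = extend h x + extend h' x"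
  by (simp add: extend_def algebra_simps sum.distrib)

lemma extend_fun_zero [simp]: "extend (\<lambda>b. 0) x = 0"
  by (simp add: extend_def)

lemma extend_fun_mult: "extend (\<lambda>b. c * h b) x = c * extend h x"
  by (simp add: extend_def sum_distrib_left mult.left_commute)

lemma extend_fun_mult_right: "extend (\<lambda>b. h b * c) x = extend h x * c"
  using extend_fun_mult[of c h x] by (simp add: mult.commute)

lemma extend_swap: "extend (\<lambda>b. extend (\<lambda>c. h b c) y) x = extend (\<lambda>c. extend (\<lambda>b. h b c) x) y"
  unfolding extend_def sum_distrib_left
  by (subst sum.swap) (simp add: mult.left_commute)

lemma extend_bracket_left: "extend (\<lambda>d. extend h (bracket d z)) p = extend h (bracket p z)"
  by (rule extend_linear_form, rule linear_formI)
    (simp_all add: bracket_add_left bracket_scale_left extend_add extend_scale)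

lemma extend_bracket_right: "extend (\<lambda>d. extend h (bracket z d)) p = extend h (bracket z p)"
  by (rule extend_linear_form, rule linear_formI)
    (simp_all add: bracket_add_right bracket_scale_right extend_add extend_scale)

definition descent_at :: "'l list \<Rightarrow> 'l list \<times> 'l \<times> 'l \<times> 'l list \<Rightarrow> bool"
  where "descent_at w = (\<lambda>(u, x, y, v). w = u @ x # y # v \<and> lt y x)"

definition some_descent :: "'l list \<Rightarrow> 'l list \<times> 'l \<times> 'l \<times> 'l list"
  where "some_descent w = (SOME d. descent_at w d)"

lemma some_descentD:
  assumes "descent_at w d" "(u, x, y, v) = some_descent w"
  shows "w = u @ x # y # v \<and> lt y x"
proof -
  have "descent_at w (some_descent w)"
    unfolding some_descent_def using assms(1) by (rule someI)
  then show ?thesis by (simp add: assms(2)[symmetric] descent_at_def)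
qed

text \<open>
  With \<open>g\<close> prescribed on sorted words, the relation \<open>x y = y x + [x, y]\<close> forces the value on a word
  with a descent: the word with \<open>x\<close> and \<open>y\<close> exchanged has fewer inversions, and the words in which
  \<open>x y\<close> is replaced by a basis element from the expansion of \<open>[x, y]\<close> are shorter. Which descent
  is used first is left to choice; that it does not matter is the content of
  \<open>straighten_descent\<close>. The values on words in basis elements are the relevant ones, as only these
  enter the multilinear extension below.
\<close>

function straighten :: "('l list \<Rightarrow> 'k) \<Rightarrow> 'l list \<Rightarrow> 'k" where
  "straighten g w = (if \<exists>d. descent_at w d
     then (case some_descent w of (u, x, y, v) \<Rightarrow>
       straighten g (u @ y # x # v) + extend (\<lambda>d. straighten g (u @ d # v)) (bracket x y))
     else g w)"
  by pat_completeness auto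
termination
  by (relation "measures [\<lambda>(g, w). length w, \<lambda>(g, w). inversions lt w]")
    (auto dest!: some_descentD simp: inversions_descent)

declare straighten.simps [simp del]

text \<open>
  The value that the relation \<open>x y = y x + [x, y]\<close> forces on the word \<open>u x y v\<close>.
\<close>

definition rewrite_at :: "('l list \<Rightarrow> 'k) \<Rightarrow> 'l list \<Rightarrow> 'l \<Rightarrow> 'l \<Rightarrow> 'l list \<Rightarrow> 'k"
  where "rewrite_at F u x y v = F (u @ y # x # v) + extend (\<lambda>d. F (u @ d # v)) (bracket x y)"

lemma rewrite_at_swap:
  assumes "F (u @ x # y # v) = rewrite_at F u x y v"
  shows "F (u @ y # x # v) = rewrite_at F u y x v"
  using assms unfolding rewrite_at_def bracket_skew[of y x] by (simp add: extend_minus)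

text \<open>
  For \<open>x < y\<close> the exchange rule is the one for the descent \<open>y x\<close> by skew symmetry of the bracket,
  and for \<open>x = y\<close> it says that \<open>[x, x] = 0\<close>. The predicate \<open>P\<close> confines it to a class of words, for
  instance those that an induction has reached.
\<close>

lemma rewrite_at_if_descents:
  assumes "\<And>u x y v. P (u @ x # y # v) \<Longrightarrow> lt y x \<Longrightarrow> F (u @ x # y # v) = rewrite_at F u x y v"
    and "P (u @ x # y # v)" "P (u @ y # x # v)"
  shows "F (u @ x # y # v) = rewrite_at F u x y v"
proof -
  consider "lt y x" | "lt x y" | "x = y" using lt_total by blast
  then show ?thesis
  proof cases
    case 3
    then show ?thesis by (simp add: rewrite_at_def bracket_self)
  qed (use assms rewrite_at_swap in blast)+
qed

text \<open>
  Independence of the descent is proved by induction on words, ordered by length and then by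
  number of inversions. The hypotheses \<open>short\<close> and \<open>less\<close> of the next two lemmas are the
  induction hypotheses; the lemmas treat the two ways in which two descents can lie in one word.
  If they are disjoint, each can still be performed after the other, and the two correction terms
  commute.
\<close>

lemma rewrite_disjoint:
  assumes short: "\<And>u x y v. length (u @ x # y # v) < length w \<Longrightarrow> F (u @ x # y # v) = rewrite_at F u x y v"
    and less: "\<And>u x y v. length (u @ x # y # v) = length w \<Longrightarrow>
      inversions lt (u @ x # y # v) < inversions lt w \<Longrightarrow> lt y x \<Longrightarrow>
      F (u @ x # y # v) = rewrite_at F u x y v"
    and w: "w = u @ x # y # t @ z # q # v" and lt: "lt y x" "lt q z"
  shows "rewrite_at F u x y (t @ z # q # v) = rewrite_at F (u @ x # y # t) z q v"
proof -
  have 1: "F (u @ y # x # t @ z # q # v) = rewrite_at F (u @ y # x # t) z q v"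
    using less[of "u @ y # x # t" z q v] inversions_descent[OF lt(1)] w lt by simp
  have 2: "F (u @ x # y # t @ q # z # v) = rewrite_at F u x y (t @ q # z # v)"
    using less[of u x y "t @ q # z # v"] lt w
      inversions_descent[OF lt(2), of "u @ x # y # t" v] by simp
  have 3: "F (u @ d # t @ z # q # v) = rewrite_at F (u @ d # t) z q v" for d
    using short[of "u @ d # t" z q v] w by simp
  have 4: "F (u @ x # y # t @ d # v) = rewrite_at F u x y (t @ d # v)" for d
    using short[of u x y "t @ d # v"] w by simp
  have "rewrite_at F u x y (t @ z # q # v) =
      F (u @ y # x # t @ q # z # v) + extend (\<lambda>d. F (u @ y # x # t @ d # v)) (bracket z q)
      + extend (\<lambda>d. F (u @ d # t @ q # z # v)) (bracket x y)
      + extend (\<lambda>d. extend (\<lambda>e. F (u @ d # t @ e # v)) (bracket z q)) (bracket x y)"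
    unfolding rewrite_at_def[of F u x y] 1 3 by (simp add: rewrite_at_def extend_fun_add)
  also have "extend (\<lambda>d. extend (\<lambda>e. F (u @ d # t @ e # v)) (bracket z q)) (bracket x y) =
     extend (\<lambda>e. extend (\<lambda>d. F (u @ d # t @ e # v)) (bracket x y)) (bracket z q)"
    by (rule extend_swap)
  also have "F (u @ y # x # t @ q # z # v) + extend (\<lambda>d. F (u @ y # x # t @ d # v)) (bracket z q)
      + extend (\<lambda>d. F (u @ d # t @ q # z # v)) (bracket x y) + \<dots>
      = rewrite_at F (u @ x # y # t) z q v"
    unfolding rewrite_at_def[of F "u @ x # y # t"] append_assoc append_Cons 2 4
    by (simp add: rewrite_at_def extend_fun_add)
  finally show ?thesis .
qed

text \<open>
  For \<open>z < y < x\<close> both ways of reversing \<open>x y z\<close> end at \<open>z y x\<close>. The correction terms on the two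
  sides have the letters \<open>[y, z], x\<close> and \<open>y, [x, z]\<close> and \<open>[x, y], z\<close>, in opposite orders. Exchanging
  them in these shorter words leaves a sum of double brackets, which is zero by the Jacobi
  identity.
\<close>

lemma rewrite_overlap:
  assumes short: "\<And>u x y v. length (u @ x # y # v) < length w \<Longrightarrow> F (u @ x # y # v) = rewrite_at F u x y v"
    and less: "\<And>u x y v. length (u @ x # y # v) = length w \<Longrightarrow>
      inversions lt (u @ x # y # v) < inversions lt w \<Longrightarrow> lt y x \<Longrightarrow>
      F (u @ x # y # v) = rewrite_at F u x y v"
    and w: "w = u @ x # y # z # v" and lt: "lt y x" "lt z y"
  shows "rewrite_at F u x y (z # v) = rewrite_at F (u @ [x]) y z v"
proof -
  note zx = lt_trans[OF lt(2) lt(1)]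
  let ?E = "\<lambda>p. extend (\<lambda>d. F (u @ d # v)) p"
  have swap: "inversions lt (u @ b # a # v) < inversions lt (u @ a # b # v)" if "lt b a" for u a b v
    using inversions_descent[OF that] .
  have a1: "inversions lt (u @ y # x # z # v) < inversions lt w"
    using swap[OF lt(1)] w by simp
  then have a2: "inversions lt (u @ y # z # x # v) < inversions lt w"
    using swap[OF zx, of "u @ [y]" v] by simp
  have b1: "inversions lt (u @ x # z # y # v) < inversions lt w"
    using swap[OF lt(2), of "u @ [x]" v] w by simp
  then have b2: "inversions lt (u @ z # x # y # v) < inversions lt w"
    using swap[OF zx, of u "y # v"] by simp
  have A1: "F (u @ y # x # z # v) = rewrite_at F (u @ [y]) x z v"
    using less[of "u @ [y]" x z v] a1 zx w by simp
  have A2: "F (u @ y # z # x # v) = rewrite_at F u y z (x # v)"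
    using less[of u y z "x # v"] a2 lt w by simp
  have B1: "F (u @ x # z # y # v) = rewrite_at F u x z (y # v)"
    using less[of u x z "y # v"] b1 zx w by simp
  have B2: "F (u @ z # x # y # v) = rewrite_at F (u @ [z]) x y v"
    using less[of "u @ [z]" x y v] b2 lt w by simp
  have comm: "extend (\<lambda>d. F (u @ d # c # v)) p = extend (\<lambda>d. F (u @ c # d # v)) p + ?E (bracket p c)" for c p
  proof -
    have "F (u @ d # c # v) = F (u @ c # d # v) + ?E (bracket d c)" for d
      using short[of u d c v] w by (simp add: rewrite_at_def)
    then show ?thesis by (simp add: extend_fun_add extend_bracket_left)
  qed
  have jac: "?E (bracket (bracket x y) z) + ?E (bracket (bracket y z) x) = ?E (bracket (bracket x z) y)"
  proof -
    have "bracket (bracket x y) z + bracket (bracket y z) x = bracket (bracket x z) y"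
    proof -
      have "bracket (bracket x z) y = bracket y (bracket z x)"
        by (metis bracket_minus_left bracket_skew)
      moreover have "bracket z (bracket x y) = - (bracket x (bracket y z) + bracket y (bracket z x))"
        using jacobi[of x y z] by (metis add.commute eq_neg_iff_add_eq_0)
      ultimately show ?thesis
        unfolding bracket_skew[of "bracket x y" z] bracket_skew[of "bracket y z" x] by simp
    qed
    then show ?thesis by (metis extend_add)
  qed
  have L: "rewrite_at F u x y (z # v) =
      F (u @ z # y # x # v) + extend (\<lambda>d. F (u @ d # x # v)) (bracket y z)
      + extend (\<lambda>d. F (u @ y # d # v)) (bracket x z) + extend (\<lambda>d. F (u @ d # z # v)) (bracket x y)"
    unfolding rewrite_at_def[of F u x y] A1 by (simp add: rewrite_at_def A2)
  have R: "rewrite_at F (u @ [x]) y z v =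
      F (u @ z # y # x # v) + extend (\<lambda>d. F (u @ z # d # v)) (bracket x y)
      + extend (\<lambda>d. F (u @ d # y # v)) (bracket x z) + extend (\<lambda>d. F (u @ x # d # v)) (bracket y z)"
    unfolding rewrite_at_def[of F "u @ [x]"] append_assoc append_Cons append_Nil B1
    by (simp add: rewrite_at_def B2)
  show ?thesis
    unfolding L R comm using jac by (simp add: algebra_simps)
qed

lemma straighten_descent:
  "w = u @ x # y # v \<Longrightarrow> lt y x \<Longrightarrow> straighten g w = rewrite_at (straighten g) u x y v"
proof (induction w arbitrary: u x y v rule: wf_induct_rule[OF wf_measures[of "[length, inversions lt]"]])
  case (1 w)
  let ?F = "straighten g"
  have less: "?F (u @ x # y # v) = rewrite_at ?F u x y v"
    if "length (u @ x # y # v) = length w" "inversions lt (u @ x # y # v) < inversions lt w" "lt y x" for u x y v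
    using 1(1)[OF _ refl] that by simp
  have short: "?F (u @ x # y # v) = rewrite_at ?F u x y v" if "length (u @ x # y # v) < length w" for u x y v
    by (rule rewrite_at_if_descents[where F = ?F and P = "\<lambda>w'. length w' < length w"]) (use 1(1)[OF _ refl] that in auto)
  have confl: "rewrite_at ?F u x y v = rewrite_at ?F u' x' y' v'"
    if "w = u @ x # y # v" "lt y x" "w = u' @ x' # y' # v'" "lt y' x'" "length u \<le> length u'"
    for u x y v u' x' y' v'
  proof -
    from that obtain s where s: "u' = u @ s" "x # y # v = s @ x' # y' # v'"
      by (metis append_eq_append_conv_if append_eq_conv_conj append_take_drop_id)
    consider "s = []" | "s = [x]" | t where "s = x # y # t"
      using s(2) by (auto simp: Cons_eq_append_conv)
    then show ?thesis
    proof cases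
      case 1
      then show ?thesis using s by simp
    next
      case 2
      then show ?thesis using s that by (auto intro: rewrite_overlap[OF short less])
    next
      case 3
      then show ?thesis using s that by (auto intro: rewrite_disjoint[OF short less])
    qed
  qed
  have ex: "descent_at w (u, x, y, v)" using 1(2,3) by (simp add: descent_at_def)
  obtain u' x' y' v' where sd: "(u', x', y', v') = some_descent w" by (metis prod_cases4)
  note d = some_descentD[OF ex sd, THEN conjunct1] some_descentD[OF ex sd, THEN conjunct2]
  have "?F w = rewrite_at ?F u' x' y' v'"
    using ex sd[symmetric] by (subst straighten.simps) (auto simp: rewrite_at_def)
  also have "\<dots> = rewrite_at ?F u x y v"
    using confl[OF d 1(2,3)] confl[OF 1(2,3) d] by (cases "length u \<le> length u'") auto
  finally show ?case .
qed

lemma straighten_rewrite: "straighten g (u @ x # y # v) = rewrite_at (straighten g) u x y v"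
  by (rule rewrite_at_if_descents[where F = "straighten g" and P = "\<lambda>_. True"], rule straighten_descent[OF refl])
    simp_all

text \<open>
  The multilinear function that agrees with \<open>F\<close> on the words in basis elements.
\<close>

fun multi_extend :: "('l list \<Rightarrow> 'k) \<Rightarrow> 'l list \<Rightarrow> 'k" where
  "multi_extend F [] = F []"
| "multi_extend F (x # w) = extend (\<lambda>b. multi_extend (\<lambda>w. F (b # w)) w) x"

lemma multi_extend_add: "multi_extend F (u @ (x + y) # v) = multi_extend F (u @ x # v) + multi_extend F (u @ y # v)"
  by (induction u arbitrary: F) (simp_all add: extend_add extend_fun_add)

lemma multi_extend_scale: "multi_extend F (u @ scale c x # v) = c * multi_extend F (u @ x # v)"
  by (induction u arbitrary: F) (simp_all add: extend_scale extend_fun_mult)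

lemma multi_extend_fun_add: "multi_extend (\<lambda>w. F w + G w) w = multi_extend F w + multi_extend G w"
  by (induction w arbitrary: F G) (simp_all add: extend_fun_add)

lemma multi_extend_fun_extend: "multi_extend (\<lambda>w. extend (\<lambda>d. G d w) p) w = extend (\<lambda>d. multi_extend (G d) w) p"
proof (induction w arbitrary: G)
  case (Cons x w)
  show ?case unfolding multi_extend.simps Cons by (rule extend_swap)
qed simp

text \<open>
  Both sides are multilinear in the letters, so the exchange rule passes from basis elements to
  all vectors. Induction on the prefix \<open>u\<close> peels off letters until \<open>x y\<close> is in front.
\<close>

lemma multi_extend_rewrite:
  assumes "\<And>u x y v. F (u @ x # y # v) = rewrite_at F u x y v"
  shows "multi_extend F (u @ x # y # v) = multi_extend F (u @ y # x # v) + multi_extend F (u @ bracket x y # v)"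
  using assms
proof (induction u arbitrary: F)
  case Nil
  define G where "G b c = multi_extend (\<lambda>w. F (b # c # w)) v" for b c
  define h where "h d = multi_extend (\<lambda>w. F (d # w)) v" for d
  have G: "G = (\<lambda>b c. G c b + extend h (bracket b c))"
  proof (intro HOL.ext)
    fix b c
    have "F (b # c # w) = F (c # b # w) + extend (\<lambda>d. F (d # w)) (bracket b c)" for w
      using Nil[of "[]" b c w] by (simp only: rewrite_at_def append_Nil)
    then have "(\<lambda>w. F (b # c # w)) = (\<lambda>w. F (c # b # w) + extend (\<lambda>d. F (d # w)) (bracket b c))"
      by (rule HOL.ext)
    then show "G b c = G c b + extend h (bracket b c)"
      unfolding h_def G_def by (simp only: multi_extend_fun_add multi_extend_fun_extend)
  qed
  have "multi_extend F (x # y # v) = extend (\<lambda>b. extend (\<lambda>c. G b c) y) x"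
    by (simp add: G_def)
  also have "\<dots> = extend (\<lambda>b. extend (\<lambda>c. G c b) y) x + extend h (bracket x y)"
    by (subst G) (simp only: extend_fun_add extend_bracket_left extend_bracket_right)
  also have "extend (\<lambda>b. extend (\<lambda>c. G c b) y) x = multi_extend F (y # x # v)"
    unfolding G_def multi_extend.simps by (rule extend_swap)
  finally show ?case by (simp add: h_def[abs_def])
next
  case (Cons a u)
  have "multi_extend (\<lambda>w. F (b # w)) (u @ x # y # v) = multi_extend (\<lambda>w. F (b # w)) (u @ y # x # v)
      + multi_extend (\<lambda>w. F (b # w)) (u @ bracket x y # v)" for b
  proof (rule Cons.IH)
    fix u x y v
    show "F (b # u @ x # y # v) = rewrite_at (\<lambda>w. F (b # w)) u x y v"
      using Cons.prems[of "b # u" x y v] by (simp only: rewrite_at_def append_Cons)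
  qed
  then show ?case by (simp add: extend_fun_add)
qed

lemma env_form_straighten: "env_form (multi_extend (straighten g))"
  unfolding env_form_def
  by (intro conjI allI multi_extend_add multi_extend_scale multi_extend_rewrite straighten_rewrite)

lemma straighten_short: "straighten g [] = g []" "straighten g [x] = g [x]"
  by (subst straighten.simps, simp add: descent_at_def)+

lemma ex_env_form_linear:
  assumes "linear_form scale f"
  shows "\<exists>\<Phi>. env_form \<Phi> \<and> (\<forall>x. \<Phi> [x] = f x)"
  by (rule exI[of _ "multi_extend (straighten (\<lambda>w. f (hd w)))"])
    (simp add: env_form_straighten straighten_short extend_linear_form[OF assms])

lemma ex_env_form_square:
  assumes "linear_form scale f"
  shows "\<exists>\<Phi>. env_form \<Phi> \<and> \<Phi> [] = 0 \<and> (\<forall>x. \<Phi> [x] = 0) \<and> (\<forall>x y. \<Phi> [x, y] = f x * f y)"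
proof -
  let ?g = "\<lambda>w. if length w = 2 then f (hd w) * f (last w) else 0"
  let ?F = "straighten ?g"
  \<comment> \<open>\<open>?g\<close> is symmetric in the two letters, and the correction term of an exchange is a
    combination of values on single letters, which are zero\<close>
  have pair: "?F [x, y] = f x * f y" for x y
  proof (cases "\<exists>d. descent_at [x, y] d")
    case True
    then have d: "descent_at [x, y] ([], x, y, [])"
      by (auto simp: descent_at_def Cons_eq_append_conv)
    then have yx: "lt y x" by (simp add: descent_at_def)
    then have no: "\<not> (\<exists>d. descent_at [y, x] d)"
      by (auto simp: descent_at_def Cons_eq_append_conv lt_asym)
    have "?F [x, y] = ?F [y, x] + extend (\<lambda>d. ?F [d]) (bracket x y)"
      using straighten_descent[of "[x, y]" "[]" x y "[]" ?g] yx by (simp add: rewrite_at_def)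
    also have "?F [y, x] = f y * f x" using no by (subst straighten.simps) simp
    finally show ?thesis by (simp add: straighten_short)
  next
    case False
    then show ?thesis by (subst straighten.simps) simp
  qed
  have "multi_extend ?F [x, y] = f x * f y" for x y
    by (simp add: pair extend_fun_mult extend_fun_mult_right extend_linear_form[OF assms])
  then show ?thesis
    by (intro exI[of _ "multi_extend ?F"]) (simp add: env_form_straighten straighten_short)
qed

end

lemma (in lie_alg) ex_letter_order: "\<exists>lt. ordered_lie_alg scale bracket lt"
proof -
  obtain r :: "'l rel" where "well_order_on UNIV r"
    using well_order_on[of UNIV] by (elim exE)
  then have r: "antisym_on UNIV r" "trans r" "total_on UNIV r"
    unfolding well_order_on_def linear_order_on_def partial_order_on_def preorder_on_def
    by simp_all
  have "ordered_lie_alg scale bracket (\<lambda>x y. (x, y) \<in> r \<and> x \<noteq> y)"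
  proof (intro ordered_lie_alg.intro lie_alg_axioms ordered_lie_alg_axioms.intro)
    fix x y z
    show "\<not> ((y, x) \<in> r \<and> y \<noteq> x)" if "(x, y) \<in> r \<and> x \<noteq> y"
      using that antisymD[OF r(1), of x y] by auto
    show "(x, z) \<in> r \<and> x \<noteq> z" if "(x, y) \<in> r \<and> x \<noteq> y" "(y, z) \<in> r \<and> y \<noteq> z"
      using that antisymD[OF r(1), of x y] transD[OF r(2), of x y z] by auto
    show "(x, y) \<in> r \<and> x \<noteq> y \<or> (y, x) \<in> r \<and> y \<noteq> x" if "x \<noteq> y"
      using that r(3) by (auto simp: total_on_def)
  qed
  then show ?thesis by blast
qed

section \<open>Forms on free vector spaces and tensor products\<close>

lemma lin_ext_eq_sum:
  assumes "vector_space sc" "finite S" "Poly_Mapping.keys s \<subseteq> S"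
  shows "lin_ext sc f s = (\<Sum>x\<in>S. sc (Poly_Mapping.lookup s x) (f x))"
proof -
  interpret vector_space sc by fact
  show ?thesis
    unfolding lin_ext_def using assms(2,3)
    by (intro sum.mono_neutral_left) (auto simp: in_keys_iff)
qed

lemma linear_form_lin_ext:
  fixes f :: "'x \<Rightarrow> 'k::field"
  shows "linear_form fscale (lin_ext (*) f)"
proof (rule linear_formI)
  fix s t :: "'x \<Rightarrow>\<^sub>0 'k"
  let ?S = "Poly_Mapping.keys s \<union> Poly_Mapping.keys t"
  have "lin_ext (*) f r = (\<Sum>x\<in>?S. Poly_Mapping.lookup r x * f x)" if "r \<in> {s, t, s + t}" for r
    using that Poly_Mapping.keys_add[of s t] by (intro lin_ext_eq_sum vector_space_mult) auto
  then show "lin_ext (*) f (s + t) = lin_ext (*) f s + lin_ext (*) f t"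
    by (simp add: lookup_add algebra_simps sum.distrib)
next
  fix c and s :: "'x \<Rightarrow>\<^sub>0 'k"
  have "lin_ext (*) f (fscale c s) = (\<Sum>x\<in>Poly_Mapping.keys s. Poly_Mapping.lookup (fscale c s) x * f x)"
    by (intro lin_ext_eq_sum vector_space_mult) (auto simp: in_keys_iff lookup_fscale)
  then show "lin_ext (*) f (fscale c s) = c * lin_ext (*) f s"
    by (simp add: lin_ext_def lookup_fscale sum_distrib_left mult.assoc)
qed

lemma lin_ext_bas [simp]: "lin_ext (*) f (bas x) = f x"
  by (simp add: lin_ext_def bas_def)

lemma linear_form_comp_lin_ext:
  assumes "linear_form sc g"
  shows "g (lin_ext sc h s) = lin_ext (*) (\<lambda>x. g (h x)) s"
  by (simp add: lin_ext_def linear_form_sum[OF assms] linear_form_scale[OF assms])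

lemma lin_ext_bas_id: "lin_ext fscale bas s = s"
proof (rule poly_mapping_eqI)
  fix x
  have "Poly_Mapping.lookup (lin_ext fscale bas s) x =
      (\<Sum>y\<in>Poly_Mapping.keys s. if y = x then Poly_Mapping.lookup s y else 0)"
    unfolding lin_ext_def lookup_sum
    by (rule sum.cong) (auto simp: lookup_fscale bas_def lookup_single when_def)
  then show "Poly_Mapping.lookup (lin_ext fscale bas s) x = Poly_Mapping.lookup s x"
    by (simp add: in_keys_iff)
qed

lemma lin_ext_mult_zero [simp]: "lin_ext (*) (\<lambda>x. 0) s = 0"
  by (simp add: lin_ext_def)

lemma linear_form_eq_zeroI:
  assumes "linear_form fscale g" "\<And>x. g (bas x) = 0"
  shows "g s = 0"
  using linear_form_comp_lin_ext[OF assms(1), of bas s] unfolding lin_ext_bas_id assms(2) by simp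

lemma lin_ext_mult_diff: "lin_ext (*) f s - lin_ext (*) g s = lin_ext (*) (\<lambda>x. f x - g x) s"
  by (simp add: lin_ext_def algebra_simps sum_subtractf)

lemma lin_ext_mult_swap:
  "lin_ext (*) (\<lambda>x. lin_ext (*) (f x) t) s = lin_ext (*) (\<lambda>y. lin_ext (*) (\<lambda>x. f x y) s) t"
  unfolding lin_ext_def sum_distrib_left by (subst sum.swap) (simp add: mult.left_commute)

text \<open>
  The form \<open>\<phi> \<otimes> \<psi>\<close>, evaluated on representatives of tensors.
\<close>

definition tensor_form :: "('v \<Rightarrow> 'k::field) \<Rightarrow> ('w \<Rightarrow> 'k) \<Rightarrow> ('v \<times> 'w \<Rightarrow>\<^sub>0 'k) \<Rightarrow> 'k"
  where "tensor_form \<phi> \<psi> = lin_ext (*) (\<lambda>(v, w). \<phi> v * \<psi> w)"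

lemma linear_form_tensor_form: "linear_form fscale (tensor_form \<phi> \<psi>)"
  unfolding tensor_form_def by (rule linear_form_lin_ext)

lemma tensor_form_rels:
  assumes "linear_form sV \<phi>" "linear_form sW \<psi>"
    and "\<And>v. v \<in> M \<Longrightarrow> \<phi> v = 0" "\<And>w. w \<in> N \<Longrightarrow> \<psi> w = 0"
    and t: "t \<in> tensor_rels sV M sW N"
  shows "tensor_form \<phi> \<psi> t = 0"
proof -
  let ?T = "tensor_form \<phi> \<psi>"
  note T = linear_form_tensor_form[of \<phi> \<psi>]
  have sub: "free.subspace {t. ?T t = 0}"
    by (auto simp: free.subspace_def linear_form_zero[OF T] linear_form_add[OF T] linear_form_scale[OF T])
  have "?T (bas (v, w)) = \<phi> v * \<psi> w" for v w
    by (simp add: tensor_form_def)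
  then have "tensor_rels sV M sW N \<subseteq> {t. ?T t = 0}"
    unfolding tensor_rels_def using assms(3,4)
    by (intro free.span_minimal sub)
      (auto simp: linear_form_diff[OF T] linear_form_scale[OF T] linear_form_add[OF assms(1)]
        linear_form_add[OF assms(2)] linear_form_scale[OF assms(1)] linear_form_scale[OF assms(2)] distrib_left distrib_right mult.left_commute)
  then show ?thesis using t by auto
qed

lemma bas_word_mult: "bas (Word u) * bas (Word v) = (bas (Word (u @ v)) :: ('l, 'k::field) free_alg)"
  by (simp add: bas_def mult_single plus_word_def)

lemma one_eq_bas: "(1 :: ('l, 'k::field) free_alg) = bas (Word [])"
  by (metis bas_def zero_word_def single_one)

lemma fscale_mult_left: "fscale c p * q = fscale c (p * q :: ('l, 'k::field) free_alg)"
  by (simp add: fscale_def mult_map_scale_conv_mult mult.assoc)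

lemma mult_fscale_right: "p * fscale c q = fscale c (p * q :: ('l, 'k::field) free_alg)"
proof -
  have bas: "bas k * fscale c q = fscale c (bas k * q)" for k :: "'l word"
    by (simp add: fscale_def mult_map_scale_conv_mult bas_def mult_single flip: mult.assoc)
  have p: "p = (\<Sum>k\<in>Poly_Mapping.keys p. fscale (Poly_Mapping.lookup p k) (bas k))"
    using lin_ext_bas_id[of p] by (simp add: lin_ext_def)
  show ?thesis
    by (subst (1 2) p)
      (simp add: sum_distrib_right fscale_mult_left bas free.scale_sum_right free.scale_left_commute mult.commute)
qed

section \<open>Evaluating forms on products in the enveloping algebra\<close>

context lie_alg
begin

definition alg_form :: "('l list \<Rightarrow> 'k) \<Rightarrow> ('l, 'k) free_alg \<Rightarrow> 'k"
  where "alg_form \<Phi> = lin_ext (*) (\<lambda>w. \<Phi> (letters w))"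

lemma linear_form_alg_form: "linear_form fscale (alg_form \<Phi>)"
  unfolding alg_form_def by (rule linear_form_lin_ext)

lemma alg_form_word [simp]: "alg_form \<Phi> (bas (Word w)) = \<Phi> w"
  by (simp add: alg_form_def)

text \<open>
  By linearity in \<open>a\<close> and \<open>b\<close> it suffices to take words for \<open>a\<close> and \<open>b\<close> in an element \<open>a s b\<close> of the
  ideal; the three kinds of relations \<open>s\<close> then match the three conditions in \<open>env_form\<close>.
\<close>

lemma alg_form_env_ideal:
  assumes "env_form \<Phi>" "p \<in> env_ideal scale bracket"
  shows "alg_form \<Phi> p = 0"
  using assms(2) unfolding env_ideal_def
proof (induction rule: two_sided_ideal.induct)
  case zero
  show ?case by (rule linear_form_zero[OF linear_form_alg_form])
next
  case (add u v)
  then show ?case by (simp add: linear_form_add[OF linear_form_alg_form])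
next
  case (base s a b)
  note lin = linear_form_add[OF linear_form_alg_form] linear_form_scale[OF linear_form_alg_form]
    linear_form_diff[OF linear_form_alg_form]
  have words: "alg_form \<Phi> (bas u * s * bas v) = 0" for u v
  proof -
    obtain u' v' where [simp]: "u = Word u'" "v = Word v'" by (metis word.exhaust)
    note expand = left_diff_distrib right_diff_distrib lin fscale_mult_left mult_fscale_right
      gen_def bas_word_mult
    note \<Phi> = assms(1)[unfolded env_form_def, THEN conjunct1, rule_format]
      assms(1)[unfolded env_form_def, THEN conjunct2, THEN conjunct1, rule_format]
    consider x y where "s = gen (x + y) - gen x - gen y"
      | c x where "s = gen (scale c x) - fscale c (gen x)"
      | x y where "s = gen x * gen y - gen y * gen x - gen (bracket x y)"
      using base by blast
    then show ?thesis
    proof cases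
      case 1
      then show ?thesis by (simp add: expand \<Phi>)
    next
      case 2
      then show ?thesis by (simp add: expand \<Phi>)
    next
      case (3 x y)
      have "\<Phi> (u' @ x # y # v') = \<Phi> (u' @ y # x # v') + \<Phi> (u' @ bracket x y # v')"
        using assms(1) unfolding env_form_def by blast
      with 3 show ?thesis by (simp add: expand)
    qed
  qed
  have left_word: "alg_form \<Phi> (bas u * s * b) = 0" for u
  proof (rule linear_form_eq_zeroI[of "\<lambda>b. alg_form \<Phi> (bas u * s * b)"])
    show "linear_form fscale (\<lambda>b. alg_form \<Phi> (bas u * s * b))"
      by (rule linear_formI) (simp_all add: distrib_left lin mult_fscale_right)
  qed (rule words)
  show ?case
  proof (rule linear_form_eq_zeroI[of "\<lambda>a. alg_form \<Phi> (a * s * b)"])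
    show "linear_form fscale (\<lambda>a. alg_form \<Phi> (a * s * b))"
      by (rule linear_formI) (simp_all add: distrib_right lin fscale_mult_left)
  qed (rule left_word)
qed

end

lemma tensor_form_bas [simp]: "tensor_form \<phi> \<psi> (bas (v, w)) = \<phi> v * \<psi> w"
  by (simp add: tensor_form_def)

lemma tensor_form_tmul:
  "tensor_form \<phi> \<psi> (tmul s t) =
    lin_ext (*) (\<lambda>x. lin_ext (*) (\<lambda>y. \<phi> (fst x * fst y) * \<psi> (snd x * snd y)) t) s"
  by (simp add: tmul_def split_def linear_form_comp_lin_ext[OF linear_form_tensor_form])

lemma lin_ext_emb2: "lin_ext (*) G (emb2 s) = lin_ext (*) (\<lambda>x. G (gen (fst x), gen (snd x))) s"
  by (simp add: emb2_def split_def linear_form_comp_lin_ext[OF linear_form_lin_ext])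

lemma lin_ext_prim: "lin_ext (*) G (prim a) = G (gen a, 1) + G (1, gen a)"
  by (simp add: prim_def linear_form_add[OF linear_form_lin_ext])

lemma lin_ext_cong:
  assumes "\<And>x. x \<in> Poly_Mapping.keys s \<Longrightarrow> f x = g x"
  shows "lin_ext sc f s = lin_ext sc g s"
  unfolding lin_ext_def by (rule sum.cong) (simp_all add: assms)

section \<open>Counits of subcoalgebras\<close>

context coassoc_coalgebra
begin

lemma delta_nonempty: "\<exists>t. t \<in> delta x"
proof -
  obtain s where "delta x = tensor_class scale s"
    using delta_in[of x] by (auto simp: tensor_square_def)
  then have "s \<in> delta x"
    by (simp add: tensor_class_def tensor_rels_def free.span_zero)
  then show ?thesis by blast
qed

lemma tensor_form_delta:
  assumes f: "linear_form scale f" and g: "linear_form scale g"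
    and "s \<in> delta x" "t \<in> delta x"
  shows "tensor_form f g s = tensor_form f g t"
proof -
  obtain r where "delta x = tensor_class scale r"
    using delta_in[of x] by (auto simp: tensor_square_def)
  then have rels: "s - r \<in> tensor_rels scale {0} scale {0}" "t - r \<in> tensor_rels scale {0} scale {0}"
    using assms(3,4) by (auto simp: tensor_class_def)
  have "tensor_form f g (u - r) = 0" if "u - r \<in> tensor_rels scale {0} scale {0}" for u
    by (rule tensor_form_rels[OF f g _ _ that])
      (auto simp: linear_form_zero[OF f] linear_form_zero[OF g])
  from this[OF rels(1)] this[OF rels(2)] show ?thesis
    by (simp add: linear_form_diff[OF linear_form_tensor_form])
qed

lemma counit_extends:
  assumes "subcoalgebra C" "counit_on C eps"
  shows "\<exists>f. linear_form scale f \<and> (\<forall>x\<in>C. f x = eps x)"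
  using assms unfolding subcoalgebra_def counit_on_def by (intro linear_form_extension) auto

text \<open>
  With \<open>f\<close> and \<open>g\<close> extending the two counits, \<open>(f \<otimes> g)(\<delta>(x))\<close> can be computed in two ways. In a
  representative supported on \<open>C \<times> C\<close> the factor \<open>f\<close> is the counit of \<open>C\<close> and leaves \<open>g(x)\<close>; in one
  supported on \<open>D \<times> D\<close> the factor \<open>g\<close> is the counit of \<open>D\<close> and leaves \<open>f(x)\<close>.
\<close>

lemma counits_agree:
  assumes C: "subcoalgebra C" "counit_on C eps" and D: "subcoalgebra D" "counit_on D eta"
    and x: "x \<in> C" "x \<in> D"
  shows "eps x = eta x"
proof -
  obtain f where f: "linear_form scale f" "\<And>y. y \<in> C \<Longrightarrow> f y = eps y"
    using counit_extends[OF C] by blast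
  obtain g where g: "linear_form scale g" "\<And>y. y \<in> D \<Longrightarrow> g y = eta y"
    using counit_extends[OF D] by blast
  obtain s where s: "s \<in> delta x" "Poly_Mapping.keys s \<subseteq> C \<times> C"
    using C(1) x(1) unfolding subcoalgebra_def by blast
  obtain t where t: "t \<in> delta x" "Poly_Mapping.keys t \<subseteq> D \<times> D"
    using D(1) x(2) unfolding subcoalgebra_def by blast
  have "g x = g (lin_ext scale (\<lambda>(a, b). scale (eps a) b) s)"
    using C(2) x(1) s unfolding counit_on_def by metis
  also have "\<dots> = tensor_form f g s"
    unfolding linear_form_comp_lin_ext[OF g(1)] tensor_form_def
    by (rule lin_ext_cong) (use s(2) f(2) linear_form_scale[OF g(1)] in auto)
  also have "\<dots> = tensor_form f g t"
    by (rule tensor_form_delta[OF f(1) g(1) s(1) t(1)])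
  also have "\<dots> = f (lin_ext scale (\<lambda>(a, b). scale (eta b) a) t)"
    unfolding linear_form_comp_lin_ext[OF f(1)] tensor_form_def
    by (rule lin_ext_cong) (use t(2) g(2) linear_form_scale[OF f(1)] in auto)
  also have "\<dots> = f x"
    using D(2) x(2) t unfolding counit_on_def by metis
  finally show ?thesis using f(2) g(2) x by simp
qed

text \<open>The map \<open>1 \<otimes> f\<close> from \<open>L \<otimes> L\<close> to \<open>L\<close>, on representatives.\<close>

definition contract :: "('l \<Rightarrow> 'k) \<Rightarrow> ('l \<times> 'l \<Rightarrow>\<^sub>0 'k) \<Rightarrow> 'l"
  where "contract f = lin_ext scale (\<lambda>(a, b). scale (f b) a)"

lemma contract_counit:
  assumes "counit_on C eps" "\<And>y. y \<in> C \<Longrightarrow> f y = eps y"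
    and "x \<in> C" "s \<in> delta x" "Poly_Mapping.keys s \<subseteq> C \<times> C"
  shows "contract f s = x"
proof -
  have "contract f s = lin_ext scale (\<lambda>(a, b). scale (eps b) a) s"
    unfolding contract_def by (rule lin_ext_cong) (use assms(2,5) in auto)
  also have "\<dots> = x" using assms(1,3-5) unfolding counit_on_def by metis
  finally show ?thesis .
qed

end

section \<open>The coradical is abelian\<close>

context coassoc_lie_alg
begin

text \<open>
  The compatibility of \<open>\<delta>\<close> with the bracket, evaluated under \<open>\<Phi> \<otimes> \<Psi>\<close>. The form \<open>\<Psi>\<close> sees only
  products of two letters and does not see their order, so that only the commutator
  \<open>[\<delta>(a), \<delta>(b)]\<close> contributes, and there only the brackets of the first tensor factors.
\<close>

lemma bracket_contract:
  assumes f: "linear_form scale f" and s: "s \<in> delta a" and t: "t \<in> delta b"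
  shows "bracket (contract f s) (contract f t) = 0"
proof (rule linear_form_separates)
  fix l assume l: "linear_form scale l"
  obtain lt where "ordered_lie_alg scale bracket lt" using ex_letter_order by blast
  then interpret ordered_lie_alg scale bracket lt .
  obtain \<Phi> where \<Phi>: "env_form \<Phi>" "\<And>x. \<Phi> [x] = l x"
    using ex_env_form_linear[OF l] by blast
  obtain \<Psi> where \<Psi>: "env_form \<Psi>" "\<Psi> [] = 0" "\<And>x. \<Psi> [x] = 0" "\<And>x y. \<Psi> [x, y] = f x * f y"
    using ex_env_form_square[OF f] by blast
  let ?T = "tensor_form (alg_form \<Phi>) (alg_form \<Psi>)"
  note T = linear_form_tensor_form[of "alg_form \<Phi>" "alg_form \<Psi>"]
  have \<Phi>2: "\<Phi> [x, y] - \<Phi> [y, x] = l (bracket x y)" for x y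
    using \<Phi> unfolding env_form_def by (metis add_diff_cancel_left' append_Nil)
  have gens: "alg_form \<Xi> (gen x) = \<Xi> [x]" "alg_form \<Xi> (gen x * gen y) = \<Xi> [x, y]"
    "alg_form \<Xi> 1 = \<Xi> []" for \<Xi> x y
    by (simp_all add: gen_def bas_word_mult one_eq_bas)
  obtain r where r: "r \<in> delta (bracket a b)" using delta_nonempty by blast
  let ?R = "tcomm (prim a) (emb2 t) + tcomm (emb2 s) (prim b) + tcomm (emb2 s) (emb2 t)"
  have "?T (emb2 r - ?R) = 0"
    by (rule tensor_form_rels[OF linear_form_alg_form linear_form_alg_form])
      (use delta_bracket[OF r s t] alg_form_env_ideal \<Phi>(1) \<Psi>(1) in \<open>auto simp: UU_eq_def\<close>)
  moreover have "?T (emb2 r) = 0"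
    by (simp add: tensor_form_def lin_ext_emb2 gens \<Psi>)
  ultimately have "?T ?R = 0"
    unfolding linear_form_diff[OF T] by (simp only: diff_0 neg_equal_0_iff_equal)
  then have "?T (tcomm (prim a) (emb2 t)) + ?T (tcomm (emb2 s) (prim b)) + ?T (tcomm (emb2 s) (emb2 t)) = 0"
    by (simp add: linear_form_add[OF T])
  moreover have "?T (tcomm (prim a) (emb2 t)) = 0" "?T (tcomm (emb2 s) (prim b)) = 0"
    by (simp_all add: tcomm_def linear_form_diff[OF T] tensor_form_tmul lin_ext_emb2 lin_ext_prim
        linear_form_add[OF linear_form_lin_ext] gens \<Psi> lin_ext_mult_diff mult.commute[of "f a"] mult.commute[of "f b"])
  moreover have "?T (tcomm (emb2 s) (emb2 t)) =
      lin_ext (*) (\<lambda>x. lin_ext (*) (\<lambda>y. l (bracket (fst x) (fst y)) * (f (snd x) * f (snd y))) t) s"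
  proof -
    have product: "?T (tmul (emb2 u) (emb2 v)) =
        lin_ext (*) (\<lambda>x. lin_ext (*) (\<lambda>y. \<Phi> [fst x, fst y] * (f (snd x) * f (snd y))) v) u" for u v
      by (simp only: tensor_form_tmul lin_ext_emb2 gens \<Psi> fst_conv snd_conv)
    have commutator: "\<Phi> [x, y] * (c * d) - \<Phi> [y, x] * (d * c) = l (bracket x y) * (c * d)" for x y c d
      by (simp add: algebra_simps flip: \<Phi>2)
    have "?T (tcomm (emb2 s) (emb2 t)) = ?T (tmul (emb2 s) (emb2 t)) - ?T (tmul (emb2 t) (emb2 s))"
      unfolding tcomm_def by (rule linear_form_diff[OF T])
    also have "?T (tmul (emb2 t) (emb2 s)) =
        lin_ext (*) (\<lambda>x. lin_ext (*) (\<lambda>y. \<Phi> [fst y, fst x] * (f (snd y) * f (snd x))) t) s"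
      unfolding product by (rule lin_ext_mult_swap)
    finally show ?thesis
      by (simp only: product lin_ext_mult_diff commutator)
  qed
  moreover have "l (bracket (contract f s) (contract f t)) =
      lin_ext (*) (\<lambda>x. lin_ext (*) (\<lambda>y. l (bracket (fst x) (fst y)) * (f (snd x) * f (snd y))) t) s"
  proof -
    have 1: "linear_form scale (\<lambda>x. l (bracket x z))" and 2: "linear_form scale (\<lambda>x. l (bracket z x))" for z
      by (auto intro!: linear_formI simp: bracket_add_left bracket_add_right bracket_scale_left
          bracket_scale_right linear_form_add[OF l] linear_form_scale[OF l])
    have left: "l (bracket (contract f s) z) = lin_ext (*) (\<lambda>x. l (bracket (scale (f (snd x)) (fst x)) z)) s" for z
      unfolding contract_def split_def by (rule linear_form_comp_lin_ext[OF 1])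
    have right: "l (bracket z (contract f t)) = lin_ext (*) (\<lambda>y. l (bracket z (scale (f (snd y)) (fst y)))) t" for z
      unfolding contract_def split_def by (rule linear_form_comp_lin_ext[OF 2])
    show ?thesis
      unfolding left unfolding right by (simp add: bracket_scale_left bracket_scale_right linear_form_scale[OF l] mult_ac)
  qed
  ultimately show "l (bracket (contract f s) (contract f t)) = 0" by simp
qed

text \<open>
  A linear form that restricts to both counits turns \<open>bracket_contract\<close> into \<open>[a, b] = 0\<close>.
\<close>

lemma counital_subcoalgebras_commute:
  assumes C: "subcoalgebra C" "counit_on C eps" and D: "subcoalgebra D" "counit_on D eta"
    and a: "a \<in> C" and b: "b \<in> D"
  shows "bracket a b = 0"
proof -
  obtain f where f: "linear_form scale f" "\<And>y. y \<in> C \<Longrightarrow> f y = eps y"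
    using counit_extends[OF C] by blast
  obtain g where g: "linear_form scale g" "\<And>y. y \<in> D \<Longrightarrow> g y = eta y"
    using counit_extends[OF D] by blast
  have "\<exists>h. linear_form scale h \<and> (\<forall>x\<in>C. h x = f x) \<and> (\<forall>x\<in>D. h x = g x)"
    using C D f g counits_agree[OF C D] by (intro linear_form_glue) (auto simp: subcoalgebra_def)
  then obtain h where h: "linear_form scale h" "\<And>x. x \<in> C \<Longrightarrow> h x = eps x" "\<And>x. x \<in> D \<Longrightarrow> h x = eta x"
    using f(2) g(2) by auto
  obtain s where s: "s \<in> delta a" "Poly_Mapping.keys s \<subseteq> C \<times> C"
    using C(1) a unfolding subcoalgebra_def by blast
  obtain t where t: "t \<in> delta b" "Poly_Mapping.keys t \<subseteq> D \<times> D"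
    using D(1) b unfolding subcoalgebra_def by blast
  show ?thesis
    using bracket_contract[OF h(1) s(1) t(1)]
    by (simp add: contract_counit[OF C(2) h(2) a s] contract_counit[OF D(2) h(3) b t])
qed

lemma coradical_abelian:
  assumes "x \<in> coradical" "y \<in> coradical"
  shows "bracket x y = 0"
proof -
  let ?G = "\<Union>{D. simple_subcoalgebra D \<and> (\<exists>eps. counit_on D eps)}"
  have gens: "bracket a b = 0" if a: "a \<in> ?G" and b: "b \<in> ?G" for a b
  proof -
    obtain C eps where C: "subcoalgebra C" "counit_on C eps" "a \<in> C"
      using a by (auto simp: simple_subcoalgebra_def)
    obtain D eta where D: "subcoalgebra D" "counit_on D eta" "b \<in> D"
      using b by (auto simp: simple_subcoalgebra_def)
    show ?thesis by (rule counital_subcoalgebras_commute[OF C(1,2) D(1,2) C(3) D(3)])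
  qed
  have right: "bracket a y = 0" if "a \<in> ?G" for a
  proof -
    have "span ?G \<subseteq> {y. bracket a y = 0}"
      by (rule span_minimal) (auto simp: subspace_def bracket_add_right bracket_scale_right
          intro: gens[OF that])
    then show ?thesis using assms(2) by (auto simp: coradical_def)
  qed
  have "span ?G \<subseteq> {x. bracket x y = 0}"
    by (rule span_minimal) (auto simp: subspace_def bracket_add_left bracket_scale_left intro: right)
  then show ?thesis using assms(1) by (auto simp: coradical_def)
qed

end

theorem proposition3p6:
  fixes scale :: "'k::alg_closed_field \<Rightarrow> 'l::ab_group_add \<Rightarrow> 'l"
  shows "(\<forall>bracket delta. coassoc_lie_alg scale bracket delta \<longrightarrow>
            module.span scale {bracket x y | x y.
              x \<in> coassoc_coalgebra.coradical scale delta \<and>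
              y \<in> coassoc_coalgebra.coradical scale delta} = {0})
       \<and> (\<forall>delta. coassoc_coalgebra scale delta \<and> coassoc_coalgebra.cosemisimple scale delta \<longrightarrow>
            (\<forall>bracket. coassoc_lie_alg scale bracket delta \<longrightarrow> (\<forall>x y. bracket x y = 0)))"
proof (intro conjI allI impI)
  fix bracket delta
  assume "coassoc_lie_alg scale bracket delta"
  then interpret coassoc_lie_alg scale bracket delta .
  have "span {bracket x y |x y. x \<in> coradical \<and> y \<in> coradical} \<subseteq> {0}"
    by (rule span_minimal) (auto simp: coradical_abelian)
  then show "span {bracket x y |x y. x \<in> coradical \<and> y \<in> coradical} = {0}"
    using span_zero by blast
next
  fix delta bracket x y
  assume "coassoc_coalgebra scale delta \<and> coassoc_coalgebra.cosemisimple scale delta"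
    and "coassoc_lie_alg scale bracket delta"
  then interpret coassoc_lie_alg scale bracket delta by simp
  show "bracket x y = 0"
    using \<open>_ \<and> coassoc_coalgebra.cosemisimple scale delta\<close>
    by (intro coradical_abelian) (simp_all add: cosemisimple_def)
qed

end
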